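(* Let $(X,\mathcal{S})$ be an $S$-metric space, let $T:X\to X$ be a self-mapping, and let $\rho=\inf\{\mathcal{S}(Tx,Tx,x):Tx\ne x,\ x\in X\}$. If $T$ is an $\mathcal{S}$-Zamfirescu type $x_0$-mapping with $x_0\in X$ and the condition $$\mathcal{S}(Tx,Tx,x_0)\le\rho$$ holds for each $x\in C^S_{x_0,\rho}$, then $C^S_{x_0,\rho}$ is a fixed circle of $T$, that is, $C^S_{x_0,\rho}\subset Fix(T)$.
   Context: An $S$-metric on a nonempty set $X$ is a function $\mathcal{S}:X\times X\times X\to[0,\infty)$ such that for all $x,y,z,w\in X$: (S1) $\mathcal{S}(x,y,z)=0$ if and only if $x=y=z$; (S2) $\mathcal{S}(x,y,z)\le\mathcal{S}(x,x,w)+\mathcal{S}(y,y,w)+\mathcal{S}(z,z,w)$. The pair $(X,\mathcal{S})$ is then an $S$-metric space. For $x_0\in X$ and $r\in[0,\infty)$ the circle is $C^S_{x_0,r}=\{x\in X:\mathcal{S}(x,x,x_0)=r\}$. $Fix(T)=\{x\in X:Tx=x\}$; the circle $C^S_{x_0,r}$ is a fixed circle of $T$ if $Tx=x$ for all $x\in C^S_{x_0,r}$. A self-mapping $T$ is an $\mathcal{S}$-Zamfirescu type $x_0$-mapping (with $x_0\in X$) if there exist $a,b\in[0,1)$ such that for all $x\in X$: $\mathcal{S}(Tx,Tx,x)>0$ implies $$\mathcal{S}(Tx,Tx,x)\le\max\left\{a\,\mathcal{S}(x,x,x_0),\ \tfrac{b}{2}\left[\mathcal{S}(Tx_0,Tx_0,x)+\mathcal{S}(Tx,Tx,x_0)\right]\right\}.$$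 *)

theory Defs
  imports Complex_Main "HOL-Library.FuncSet"
begin

locale S_metric_space =
  fixes X :: "'a set" and S :: "'a \<Rightarrow> 'a \<Rightarrow> 'a \<Rightarrow> real"
  assumes nonempty: "X \<noteq> {}"
    and nonneg: "\<lbrakk>x \<in> X; y \<in> X; z \<in> X\<rbrakk> \<Longrightarrow> 0 \<le> S x y z"
    and zero_iff: "\<lbrakk>x \<in> X; y \<in> X; z \<in> X\<rbrakk> \<Longrightarrow> S x y z = 0 \<longleftrightarrow> x = y \<and> y = z"
    and triangle: "\<lbrakk>x \<in> X; y \<in> X; z \<in> X; w \<in> X\<rbrakk> \<Longrightarrow> S x y z \<le> S x x w + S y y w + S z z w"

definition S_circle :: "'a set \<Rightarrow> ('a \<Rightarrow> 'a \<Rightarrow> 'a \<Rightarrow> real) \<Rightarrow> 'a \<Rightarrow> real \<Rightarrow> 'a set" where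
  "S_circle X S x0 r = {x \<in> X. S x x x0 = r}"

definition Fix :: "'a set \<Rightarrow> ('a \<Rightarrow> 'a) \<Rightarrow> 'a set" where
  "Fix X T = {x \<in> X. T x = x}"

definition fixed_circle :: "('a \<Rightarrow> 'a) \<Rightarrow> 'a set \<Rightarrow> bool" where
  "fixed_circle T C \<longleftrightarrow> (\<forall>x\<in>C. T x = x)"

definition S_Zamfirescu_mapping ::
    "'a set \<Rightarrow> ('a \<Rightarrow> 'a \<Rightarrow> 'a \<Rightarrow> real) \<Rightarrow> 'a \<Rightarrow> ('a \<Rightarrow> 'a) \<Rightarrow> bool" where
  "S_Zamfirescu_mapping X S x0 T \<longleftrightarrow>
    T \<in> X \<rightarrow> X \<and> x0 \<in> X \<and>
    (\<exists>a\<in>{0..<1}. \<exists>b\<in>{0..<1}. \<forall>x\<in>X. S (T x) (T x) x > 0 \<longrightarrow>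
      S (T x) (T x) x \<le> max (a * S x x x0) (b / 2 * (S (T x0) (T x0) x + S (T x) (T x) x0)))"

end

theory Submission
  imports Defs
begin

text \<open>
  Two contradictions with the factors \<open>a, b < 1\<close> give the result. At the centre the
  first term of the maximum vanishes and the second one is \<open>b\<close> times the displacement of
  \<open>x0\<close> itself, so \<open>x0\<close> is a fixed point (\<open>Zamfirescu_centre_fixed\<close>). Hence, for a point \<open>x\<close>
  on the circle of radius \<open>\<rho>\<close>, the term \<open>S (T x0) (T x0) x\<close> is just the radius, by the
  symmetry \<open>S x x y = S y y x\<close>; with the bound on \<open>S (T x) (T x) x0\<close> the contractive
  condition limits the displacement of \<open>x\<close> to \<open>max a b * \<rho>\<close>. If \<open>x\<close> were moved, its displacement
  would be positive and, by the choice of \<open>\<rho>\<close> as an infimum, at least \<open>\<rho>\<close>, hence it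
  would be at most \<open>max a b < 1\<close> times itself.
\<close>

text \<open>
  Apply the triangle inequality with the first point as the intermediate one: two of the
  three terms vanish.
\<close>

lemma (in S_metric_space) symmetric:
  assumes "x \<in> X" and "y \<in> X"
  shows "S x x y = S y y x"
proof (rule antisym)
  show "S x x y \<le> S y y x"
    using triangle[of x x y x] zero_iff[of x x x] assms by simp
  show "S y y x \<le> S x x y"
    using triangle[of y y x y] zero_iff[of y y y] assms by simp
qed

lemma (in S_metric_space) displacement_pos:
  assumes "x \<in> X" and "y \<in> X" and "y \<noteq> x"
  shows "0 < S y y x"
  using nonneg[of y y x] zero_iff[of y y x] assms by force

lemma (in S_metric_space) Zamfirescu_centre_fixed:
  assumes "S_Zamfirescu_mapping X S x0 T"
  shows "T x0 = x0"
proof (rule ccontr)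
  assume moved: "T x0 \<noteq> x0"
  define t where "t = S (T x0) (T x0) x0"
  obtain a b where b: "0 \<le> b" "b < 1" and x0: "x0 \<in> X" and Tx0: "T x0 \<in> X"
    and contr: "\<And>x. x \<in> X \<Longrightarrow> S (T x) (T x) x > 0 \<Longrightarrow>
      S (T x) (T x) x \<le> max (a * S x x x0) (b / 2 * (S (T x0) (T x0) x + S (T x) (T x) x0))"
    using assms unfolding S_Zamfirescu_mapping_def by fastforce
  have "t > 0"
    unfolding t_def using displacement_pos x0 Tx0 moved by blast
  then have "t \<le> max (a * S x0 x0 x0) (b / 2 * (t + t))"
    using contr[OF x0] by (simp only: t_def)
  moreover have "S x0 x0 x0 = 0"
    using zero_iff x0 by blast
  ultimately show False
    using b \<open>t > 0\<close> by (simp add: le_max_iff_disj)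
qed

theorem theorem3p2:
  fixes X :: "'a set" and S :: "'a \<Rightarrow> 'a \<Rightarrow> 'a \<Rightarrow> real"
    and T :: "'a \<Rightarrow> 'a" and x0 :: 'a and \<rho> :: real
  assumes "S_metric_space X S"
    and "T \<in> X \<rightarrow> X"
    and "\<rho> = Inf {S (T x) (T x) x | x. x \<in> X \<and> T x \<noteq> x}"
    and "x0 \<in> X"
    and "S_Zamfirescu_mapping X S x0 T"
    and "\<forall>x \<in> S_circle X S x0 \<rho>. S (T x) (T x) x0 \<le> \<rho>"
  shows "fixed_circle T (S_circle X S x0 \<rho>) \<and> S_circle X S x0 \<rho> \<subseteq> Fix X T"
proof -
  interpret S_metric_space X S by fact
  have centre: "T x0 = x0"
    using assms(5) by (rule Zamfirescu_centre_fixed)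
  obtain a b where a: "0 \<le> a" "a < 1" and b: "0 \<le> b" "b < 1"
    and contr: "\<And>x. x \<in> X \<Longrightarrow> S (T x) (T x) x > 0 \<Longrightarrow>
      S (T x) (T x) x \<le> max (a * S x x x0) (b / 2 * (S (T x0) (T x0) x + S (T x) (T x) x0))"
    using assms(5) unfolding S_Zamfirescu_mapping_def by fastforce
  have fixed: "T x = x" if "x \<in> S_circle X S x0 \<rho>" for x
  proof (rule ccontr)
    assume moved: "T x \<noteq> x"
    define t where "t = S (T x) (T x) x"
    define c where "c = max a b"
    from that have x: "x \<in> X" and radius: "S x x x0 = \<rho>"
      by (auto simp: S_circle_def)
    have Tx: "T x \<in> X"
      using assms(2) x by blast
    have "\<rho> \<ge> 0"
      using nonneg[of x x x0] x assms(4) radius by simp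
    have "t > 0"
      unfolding t_def using displacement_pos x Tx moved by blast
    have "\<rho> \<le> t"
      unfolding assms(3) t_def
    proof (rule cInf_lower)
      show "bdd_below {S (T x) (T x) x | x. x \<in> X \<and> T x \<noteq> x}"
        using assms(2) nonneg by (intro bdd_belowI[of _ 0]) auto
    qed (use x moved in blast)
    have "S (T x0) (T x0) x = \<rho>"
      using symmetric[OF x assms(4)] radius centre by simp
    moreover have "S (T x) (T x) x0 \<le> \<rho>"
      using assms(6) that by blast
    ultimately have "b / 2 * (S (T x0) (T x0) x + S (T x) (T x) x0) \<le> b / 2 * (\<rho> + \<rho>)"
      using b by (intro mult_left_mono) auto
    then have "t \<le> max (a * \<rho>) (b * \<rho>)"
      using contr[OF x] \<open>t > 0\<close> radius by (auto simp: t_def)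
    also have "\<dots> \<le> c * \<rho>"
      using \<open>\<rho> \<ge> 0\<close> by (auto simp: c_def intro: mult_right_mono)
    also have "\<dots> \<le> c * t"
      using \<open>\<rho> \<le> t\<close> a by (intro mult_left_mono) (auto simp: c_def)
    also have "\<dots> < t"
      using \<open>t > 0\<close> a b by (simp add: c_def)
    finally show False
      by simp
  qed
  then show ?thesis
    by (auto simp: fixed_circle_def Fix_def S_circle_def)
qed

end
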